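(* For each integer $n \geqslant 13$, let $b_n$ denote the number of solutions in integers $x_1,\ldots,x_n$ of the system $B_n$: \[ \left\{\begin{array}{rcl} \forall i \in \{1,\ldots,n-13\} ~x_i \cdot x_i &=& x_{i+1} \\ x_{n-11}+x_{n-11} &=& x_{1} \\ x_{n-11} \cdot x_{n-11} &=& x_{1} \\ x_{n-10} \cdot x_{n-10} &=& x_{n-9} \\ x_{n-8} \cdot x_{n-8} &=& x_{n-7} \\ x_{n-6} \cdot x_{n-6} &=& x_{n-5} \\ x_{n-4} \cdot x_{n-4} &=& x_{n-3} \\ x_{n-9}+x_{n-7} &=& x_{n-2} \\ x_{n-5}+x_{n-3} &=& x_{n-1} \\ x_{n-2}+x_{n-1} &=& x_{n} \\ x_{n-11}+x_{n-12} &=& x_{n} \end{array}\right. \] and for each integer $n \geqslant 12$ let $t_n$ denote the number of solutions in integers $x_1,\ldots,x_n$ of the system $T_n$: \[ \left\{\begin{array}{rcl} \forall i \in \{1,\ldots,n-12\} ~x_i \cdot x_i &=& x_{i+1} \\ x_{n-10} \cdot x_{n-10} &=& x_{n-10} \\ x_{n-10}+x_{n-10} &=& x_{n-9} \\ x_{n-8}+x_{n-9} &=& x_{1} \\ x_{n-8} \cdot x_{n-7} &=& x_{n-11} \\ x_{n-10} \cdot x_{n-7} &=& x_{n-7} \\ x_{n-6} \cdot x_{n-6} &=& x_{n-5} \\ x_{n-4} \cdot x_{n-4} &=& x_{n-3} \\ x_{n-2} \cdot x_{n-2} &=& x_{n-1} \\ x_{n-5}+x_{n-3} &=& x_n \\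 x_{n-1}+x_n &=& x_{n-11} \end{array}\right. \] Then $b_n$ and $t_n$ are finite positive integers and $\displaystyle \lim_{n \to \infty} \frac{t_n}{b_n}=\infty$. *)

theory Defs
  imports Complex_Main "HOL-Library.FuncSet"
begin

text \<open>An integer tuple \<open>x\<^sub>1, \<dots>, x\<^sub>n\<close> is a function in \<open>{1..n} \<rightarrow>\<^sub>E UNIV\<close>, i.e. one that
  is fixed to \<open>undefined\<close> outside \<open>{1..n}\<close>, so that distinct functions are distinct tuples.
  The subtractions on indices do not truncate for \<open>n \<ge> 13\<close> (system \<open>B\<close>) and \<open>n \<ge> 12\<close>
  (system \<open>T\<close>), the only cases considered.\<close>

definition B_system :: "nat \<Rightarrow> (nat \<Rightarrow> int) \<Rightarrow> bool" where
  "B_system n x \<longleftrightarrow>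
    (\<forall>i\<in>{1..n-13}. x i * x i = x (i+1)) \<and>
    x (n-11) + x (n-11) = x 1 \<and>
    x (n-11) * x (n-11) = x 1 \<and>
    x (n-10) * x (n-10) = x (n-9) \<and>
    x (n-8) * x (n-8) = x (n-7) \<and>
    x (n-6) * x (n-6) = x (n-5) \<and>
    x (n-4) * x (n-4) = x (n-3) \<and>
    x (n-9) + x (n-7) = x (n-2) \<and>
    x (n-5) + x (n-3) = x (n-1) \<and>
    x (n-2) + x (n-1) = x n \<and>
    x (n-11) + x (n-12) = x n"

definition T_system :: "nat \<Rightarrow> (nat \<Rightarrow> int) \<Rightarrow> bool" where
  "T_system n x \<longleftrightarrow>
    (\<forall>i\<in>{1..n-12}. x i * x i = x (i+1)) \<and>
    x (n-10) * x (n-10) = x (n-10) \<and>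
    x (n-10) + x (n-10) = x (n-9) \<and>
    x (n-8) + x (n-9) = x 1 \<and>
    x (n-8) * x (n-7) = x (n-11) \<and>
    x (n-10) * x (n-7) = x (n-7) \<and>
    x (n-6) * x (n-6) = x (n-5) \<and>
    x (n-4) * x (n-4) = x (n-3) \<and>
    x (n-2) * x (n-2) = x (n-1) \<and>
    x (n-5) + x (n-3) = x n \<and>
    x (n-1) + x n = x (n-11)"

definition B_solutions :: "nat \<Rightarrow> (nat \<Rightarrow> int) set" where
  "B_solutions n = {x \<in> {1..n} \<rightarrow>\<^sub>E UNIV. B_system n x}"

definition T_solutions :: "nat \<Rightarrow> (nat \<Rightarrow> int) set" where
  "T_solutions n = {x \<in> {1..n} \<rightarrow>\<^sub>E UNIV. T_system n x}"

definition b_count :: "nat \<Rightarrow> nat" where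
  "b_count n = card (B_solutions n)"

definition t_count :: "nat \<Rightarrow> nat" where
  "t_count n = card (T_solutions n)"

end

theory Submission
  imports Defs "HOL-Computational_Algebra.Primes" "HOL-Library.Product_Plus"
begin

text \<open>
  Put \<open>K = 2 ^ (n - 13)\<close>. In \<open>B\<^sub>n\<close> the first coordinate is \<open>0\<close> or \<open>4\<close>, so a solution is a
  representation of \<open>0\<close> or of \<open>2 + 4 ^ K\<close> as a sum of four squares; three of the four roots
  together with the sign of the last one determine it, so \<open>b\<^sub>n = O(8 ^ K)\<close>.

  In \<open>T\<^sub>n\<close> the first coordinate \<open>x\<^sub>1\<close> is \<open>0\<close>, or \<open>x\<^sub>1 - 2\<close> divides a power of \<open>x\<^sub>1\<close>, hence a power
  of \<open>2\<close>. The choice \<open>x\<^sub>1 = 34 = 2 + 2 ^ 5\<close> alone contributes all integer points on the sphere of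
  radius \<open>34 ^ K\<close>. There are at least \<open>9 ^ (K - 1)\<close> of them: for nine quaternions \<open>q\<close> of norm
  \<open>17\<close>, no two of which are equal or conjugate up to units, the maps \<open>v \<mapsto> q v q\<^sup>*\<close> multiply lengths
  by \<open>17\<close>, and modulo \<open>17\<close> each has rank one, so that the line containing \<open>q v q\<^sup>*\<close> modulo \<open>17\<close>
  reveals \<open>q\<close>. Since \<open>9 > 8\<close>, the quotient tends to infinity.
\<close>

section \<open>Integer points on spheres of radius a power of 17\<close>

type_synonym vec3 = "int \<times> int \<times> int"

fun dot3 :: "vec3 \<Rightarrow> vec3 \<Rightarrow> int" where
  "dot3 (a, b, c) (x, y, z) = a * x + b * y + c * z"

fun quat_norm :: "int \<times> int \<times> int \<times> int \<Rightarrow> int" where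
  "quat_norm (a, b, c, d) = a\<^sup>2 + b\<^sup>2 + c\<^sup>2 + d\<^sup>2"

text \<open>The map \<open>v \<mapsto> q v q\<^sup>*\<close> on pure quaternions, for \<open>q = a + b i + c j + d k\<close>.\<close>

fun sandwich :: "int \<times> int \<times> int \<times> int \<Rightarrow> vec3 \<Rightarrow> vec3" where
  "sandwich (a, b, c, d) (x, y, z) =
    ((a\<^sup>2 + b\<^sup>2 - c\<^sup>2 - d\<^sup>2) * x + 2 * (b * c - a * d) * y + 2 * (b * d + a * c) * z,
     2 * (b * c + a * d) * x + (a\<^sup>2 - b\<^sup>2 + c\<^sup>2 - d\<^sup>2) * y + 2 * (c * d - a * b) * z,
     2 * (b * d - a * c) * x + 2 * (c * d + a * b) * y + (a\<^sup>2 - b\<^sup>2 - c\<^sup>2 + d\<^sup>2) * z)"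

text \<open>The matrix of \<open>sandwich q\<close> has pairwise orthogonal columns of squared
  length \<open>N\<close>, so the map is a similarity with factor
  \<open>quat_norm q\<close>.\<close>

lemma dot3_sandwich:
  "dot3 (sandwich q v) (sandwich q w) = (quat_norm q)\<^sup>2 * dot3 v w"
proof -
  obtain a b c d where q: "q = (a, b, c, d)" by (cases q)
  obtain x y z where v: "v = (x, y, z)" by (cases v)
  obtain x' y' z' where w: "w = (x', y', z')" by (cases w)
  define N where "N = (a\<^sup>2 + b\<^sup>2 + c\<^sup>2 + d\<^sup>2)\<^sup>2"
  \<comment> \<open>Opaque names for the entries keep the expansion below bilinear; only
    \<open>orth\<close> looks inside them.\<close>
  define m11 m12 m13 where m1: "m11 = a\<^sup>2 + b\<^sup>2 - c\<^sup>2 - d\<^sup>2" "m12 = 2 * (b * c - a * d)"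
    "m13 = 2 * (b * d + a * c)"
  define m21 m22 m23 where m2: "m21 = 2 * (b * c + a * d)" "m22 = a\<^sup>2 - b\<^sup>2 + c\<^sup>2 - d\<^sup>2"
    "m23 = 2 * (c * d - a * b)"
  define m31 m32 m33 where m3: "m31 = 2 * (b * d - a * c)" "m32 = 2 * (c * d + a * b)"
    "m33 = a\<^sup>2 - b\<^sup>2 - c\<^sup>2 + d\<^sup>2"
  have orth: "m11 * m11 + m21 * m21 + m31 * m31 = N" "m12 * m12 + m22 * m22 + m32 * m32 = N"
    "m13 * m13 + m23 * m23 + m33 * m33 = N" "m11 * m12 + m21 * m22 + m31 * m32 = 0"
    "m11 * m13 + m21 * m23 + m31 * m33 = 0" "m12 * m13 + m22 * m23 + m32 * m33 = 0"
    unfolding N_def m1 m2 m3 by algebra+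
  have "(m11 * x + m12 * y + m13 * z) * (m11 * x' + m12 * y' + m13 * z')
      + (m21 * x + m22 * y + m23 * z) * (m21 * x' + m22 * y' + m23 * z')
      + (m31 * x + m32 * y + m33 * z) * (m31 * x' + m32 * y' + m33 * z')
    = (m11 * m11 + m21 * m21 + m31 * m31) * (x * x')
      + (m12 * m12 + m22 * m22 + m32 * m32) * (y * y')
      + (m13 * m13 + m23 * m23 + m33 * m33) * (z * z')
      + (m11 * m12 + m21 * m22 + m31 * m32) * (x * y' + y * x')
      + (m11 * m13 + m21 * m23 + m31 * m33) * (x * z' + z * x')
      + (m12 * m13 + m22 * m23 + m32 * m33) * (y * z' + z * y')"
    by (simp add: algebra_simps)
  also have "\<dots> = N * (x * x' + y * y' + z * z')"
    unfolding orth by (simp add: algebra_simps)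
  finally show ?thesis
    unfolding q v w sandwich.simps dot3.simps quat_norm.simps N_def m1 m2 m3 .
qed

lemma sandwich_diff:
  "sandwich q v - sandwich q w = sandwich q (v - w)"
  by (cases q; cases v; cases w) (simp add: algebra_simps)

lemma dot3_self_eq_0: "dot3 v v = 0 \<longleftrightarrow> v = 0"
proof (cases v)
  case (fields x y z)
  have "x * x = 0 \<and> y * y = 0 \<and> z * z = 0" if "x * x + y * y + z * z = 0"
    using that zero_le_square[of x] zero_le_square[of y] zero_le_square[of z] by linarith
  then show ?thesis
    by (auto simp: fields zero_prod_def)
qed

lemma inj_sandwich:
  assumes "quat_norm q \<noteq> 0"
  shows "inj (sandwich q)"
proof (rule injI)
  fix v w assume "sandwich q v = sandwich q w"
  then have "sandwich q (v - w) = 0"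
    by (simp flip: sandwich_diff)
  then have "(quat_norm q)\<^sup>2 * dot3 (v - w) (v - w) = 0"
    by (metis dot3_sandwich dot3_self_eq_0)
  then show "v = w"
    using assms by (simp add: dot3_self_eq_0)
qed

text \<open>The triples \<open>(q, u, f)\<close> satisfy \<open>q v q\<^sup>* \<equiv> (f \<bullet> v) u\<close> modulo \<open>17\<close>.\<close>

definition quats17 :: "((int \<times> int \<times> int \<times> int) \<times> vec3 \<times> vec3) set" where
  "quats17 =
    {((4, 1, 0, 0), (0, 1, -4), (0, -2, -8)),
     ((4, 0, 1, 0), (1, 0, 4), (-2, 0, 8)),
     ((4, 0, 0, 1), (1, -4, 0), (-2, -8, 0)),
     ((3, 2, 2, 0), (1, -1, -7), (-8, 8, -5)),
     ((3, 2, -2, 0), (1, 1, 7), (-8, -8, 5)),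
     ((3, 0, 2, 2), (1, -5, 5), (1, 5, -5)),
     ((3, 0, 2, -2), (1, 5, 5), (1, -5, -5)),
     ((3, 2, 0, 2), (1, 7, -1), (-8, 5, 8)),
     ((3, -2, 0, 2), (1, 7, 1), (-8, 5, -8))}"

lemma card_quats17: "card quats17 = 9"
  by (simp add: quats17_def)

lemma finite_quats17: "finite quats17"
  by (simp add: quats17_def)

lemma quat_norm_quats17: "(q, u, f) \<in> quats17 \<Longrightarrow> quat_norm q = 17"
  by (auto simp: quats17_def)

lemma quats17_rank_one:
  assumes "(q, u, f) \<in> quats17"
  shows "17 dvd dot3 g (sandwich q v) - dot3 f v * dot3 g u"
proof -
  obtain x y z where v: "v = (x, y, z)" by (cases v)
  obtain a b c where g: "g = (a, b, c)" by (cases g)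
  obtain u1 u2 u3 where u: "u = (u1, u2, u3)" by (cases u)
  obtain r s t where r: "sandwich q v = (r, s, t)" by (cases "sandwich q v")
  \<comment> \<open>In each of the nine cases \<open>q\<close> is numeric, so these congruences are
    linear in \<open>x\<close>, \<open>y\<close>, \<open>z\<close>.\<close>
  have "17 dvd r - dot3 f v * u1 \<and> 17 dvd s - dot3 f v * u2 \<and> 17 dvd t - dot3 f v * u3"
    using assms r unfolding quats17_def v u
    by (elim insertE emptyE; simp; presburger)
  then have "17 dvd a * (r - dot3 f v * u1) + b * (s - dot3 f v * u2) + c * (t - dot3 f v * u3)"
    by (intro dvd_add dvd_mult) auto
  then show ?thesis
    by (simp add: r g u algebra_simps)
qed

text \<open>No image line lies in the kernel modulo 17 of any of the nine maps, so the maps can be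
  composed without degenerating.\<close>

lemma quats17_form_nonzero:
  "(q, u, f) \<in> quats17 \<Longrightarrow> (q', u', f') \<in> quats17 \<Longrightarrow> \<not> 17 dvd dot3 f u'"
  unfolding quats17_def by (elim insertE emptyE; simp)

text \<open>Read as a linear form modulo 17, \<open>u\<close> vanishes on its own image line but, by
  the next lemma, on none of the other eight. Pairing with \<open>u\<close> thus recognises the
  map.\<close>

lemma quats17_isotropic:
  "(q, u, f) \<in> quats17 \<Longrightarrow> 17 dvd dot3 u u"
  unfolding quats17_def by (elim insertE emptyE; simp)

lemma quats17_not_orthogonal:
  "(q, u, f) \<in> quats17 \<Longrightarrow> (q', u', f') \<in> quats17 \<Longrightarrow> (q, u, f) \<noteq> (q', u', f') \<Longrightarrow>
    \<not> 17 dvd dot3 u u'"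
  unfolding quats17_def by (elim insertE emptyE; simp)

text \<open>Modulo 17 the left-hand value is the product of \<open>dot3 f v\<close> and
  \<open>dot3 g u\<close>, and 17 is prime.\<close>

lemma quats17_dvd_dot3_sandwich:
  assumes "(q, u, f) \<in> quats17"
  shows "17 dvd dot3 g (sandwich q v) \<longleftrightarrow> 17 dvd dot3 f v \<or> 17 dvd dot3 g u"
proof -
  have "prime (17::int)" by simp
  then have "17 dvd dot3 f v \<or> 17 dvd dot3 g u \<longleftrightarrow> 17 dvd dot3 f v * dot3 g u"
    by (simp add: prime_dvd_mult_iff)
  also have "\<dots> \<longleftrightarrow> 17 dvd dot3 g (sandwich q v)"
    using quats17_rank_one[OF assms, of g v]
    by (metis dvd_diff_commute dvd_diffD dvd_diffD1 dvd_add_right_iff diff_add_cancel)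
  finally show ?thesis ..
qed

section \<open>Nine disjoint copies of each sphere inside the next\<close>

text \<open>The second condition avoids the kernels modulo 17 of all nine maps: every image is then
  nonzero modulo 17 and spans a line that identifies the map.\<close>

definition sphere17 :: "nat \<Rightarrow> vec3 set" where
  "sphere17 m = {v. dot3 v v = (17 ^ m)\<^sup>2 \<and> (\<forall>(q, u, f)\<in>quats17. \<not> 17 dvd dot3 f v)}"

lemma abs_le_self_mult: "\<bar>a\<bar> \<le> a * a" for a :: int
  by (metis abs_ge_zero abs_mult_self_eq abs_of_nonneg int_one_le_iff_zero_less le_less
      mult.right_neutral mult_left_mono mult_zero_left)

lemma finite_sphere17: "finite (sphere17 m)"
proof (rule finite_subset)
  let ?I = "{- (17 ^ m)\<^sup>2..(17 ^ m)\<^sup>2} :: int set"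
  show "sphere17 m \<subseteq> ?I \<times> ?I \<times> ?I"
  proof
    fix v assume v: "v \<in> sphere17 m"
    obtain x y z where xyz: "v = (x, y, z)" by (cases v)
    have "x * x + y * y + z * z = (17 ^ m)\<^sup>2"
      using v by (simp add: sphere17_def xyz)
    then show "v \<in> ?I \<times> ?I \<times> ?I"
      using abs_le_self_mult[of x] abs_le_self_mult[of y] abs_le_self_mult[of z]
      by (simp add: xyz) linarith
  qed
qed simp

lemma sandwich_sphere17:
  assumes "(q, u, f) \<in> quats17" "v \<in> sphere17 m"
  shows "sandwich q v \<in> sphere17 (Suc m)"
proof -
  have "dot3 (sandwich q v) (sandwich q v) = (17 ^ Suc m)\<^sup>2"
    using assms by (simp add: dot3_sandwich quat_norm_quats17 sphere17_def power_mult_distrib)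
  moreover have "\<not> 17 dvd dot3 f' (sandwich q v)" if "(q', u', f') \<in> quats17" for q' u' f'
    using assms quats17_form_nonzero[OF that assms(1)]
    by (auto simp: quats17_dvd_dot3_sandwich sphere17_def)
  ultimately show ?thesis
    by (auto simp: sphere17_def)
qed

text \<open>Pairing the common image with \<open>u\<close> gives 0 modulo 17 when it is computed
  through \<open>q\<close>, but a nonzero residue through \<open>q'\<close> if the triples
  differ.\<close>

lemma sandwich_quats17_eqD:
  assumes "(q, u, f) \<in> quats17" "(q', u', f') \<in> quats17" "w \<in> sphere17 m"
    and eq: "sandwich q v = sandwich q' w"
  shows "(q, u, f) = (q', u', f')"
proof (rule ccontr)
  assume "(q, u, f) \<noteq> (q', u', f')"
  then have "\<not> 17 dvd dot3 u u'"
    using assms quats17_not_orthogonal by blast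
  moreover have "\<not> 17 dvd dot3 f' w"
    using assms by (auto simp: sphere17_def)
  ultimately have "\<not> 17 dvd dot3 u (sandwich q v)"
    using quats17_dvd_dot3_sandwich[OF assms(2)] eq by simp
  then show False
    using quats17_dvd_dot3_sandwich[OF assms(1)] quats17_isotropic[OF assms(1)] by simp
qed

lemma card_sphere17_Suc: "9 * card (sphere17 m) \<le> card (sphere17 (Suc m))"
proof -
  let ?A = "\<lambda>t. sandwich (fst t) ` sphere17 m"
  have card_A: "card (?A t) = card (sphere17 m)" if "t \<in> quats17" for t
  proof -
    obtain q u f where t: "t = (q, u, f)" by (cases t)
    have "inj (sandwich q)"
      using that quat_norm_quats17 by (intro inj_sandwich) (auto simp: t)
    then show ?thesis
      by (auto simp: t intro!: card_image inj_on_subset[of _ UNIV])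
  qed
  have "?A s \<inter> ?A t = {}" if st: "s \<in> quats17" "t \<in> quats17" "s \<noteq> t" for s t
  proof (rule ccontr)
    assume "?A s \<inter> ?A t \<noteq> {}"
    then obtain p where "p \<in> ?A s" "p \<in> ?A t"
      by blast
    then obtain v w where "sandwich (fst s) v = sandwich (fst t) w" "w \<in> sphere17 m"
      unfolding image_iff by metis
    then have "s = t"
      using st sandwich_quats17_eqD[of "fst s" "fst (snd s)" "snd (snd s)"
          "fst t" "fst (snd t)" "snd (snd t)" w m v]
      by simp
    with st show False by blast
  qed
  then have "card (\<Union>t\<in>quats17. ?A t) = (\<Sum>t\<in>quats17. card (?A t))"
    by (intro card_UN_disjoint) (auto simp: finite_quats17 finite_sphere17)
  also have "\<dots> = 9 * card (sphere17 m)"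
    by (simp add: card_A card_quats17)
  finally have "9 * card (sphere17 m) = card (\<Union>t\<in>quats17. ?A t)" ..
  also have "\<dots> \<le> card (sphere17 (Suc m))"
  proof (intro card_mono finite_sphere17 UN_least image_subsetI)
    show "sandwich (fst t) v \<in> sphere17 (Suc m)" if "t \<in> quats17" "v \<in> sphere17 m" for t v
      using that sandwich_sphere17[of "fst t" "fst (snd t)" "snd (snd t)"] by simp
  qed
  finally show ?thesis .
qed

lemma card_sphere17: "9 ^ m \<le> card (sphere17 (Suc m))"
proof (induction m)
  case 0
  \<comment> \<open>\<open>81 + 144 + 64 = 17 ^ 2\<close>. Radius 1 cannot start the induction: each
    of the six unit vectors is annihilated by one of the forms \<open>f\<close>.\<close>
  have "(9, 12, 8) \<in> sphere17 1"
    by (simp add: sphere17_def quats17_def)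
  then show ?case
    using finite_sphere17[of 1] by (auto simp: Suc_le_eq card_gt_0_iff)
next
  case (Suc m)
  then show ?case
    using card_sphere17_Suc[of "Suc m"] by simp
qed

section \<open>The two systems\<close>

lemma squaring_chain:
  fixes x :: "nat \<Rightarrow> int"
  assumes "\<forall>i\<in>{1..m}. x i * x i = x (i + 1)" "j \<le> m"
  shows "x (Suc j) = x 1 ^ (2 ^ j)"
  using assms(2)
proof (induction j)
  case (Suc j)
  have "x (Suc (Suc j)) = x (Suc j) * x (Suc j)"
    using assms(1) Suc.prems by simp
  also have "\<dots> = x 1 ^ (2 ^ Suc j)"
    using Suc by (simp add: mult_2 power_add)
  finally show ?case .
qed simp

text \<open>Writing \<open>n = m + 13\<close> removes the truncated subtraction from the
  indices.\<close>

lemma B_system_shift: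
  "B_system (m + 13) x \<longleftrightarrow>
    (\<forall>i\<in>{1..m}. x i * x i = x (i + 1)) \<and>
    x (m + 2) + x (m + 2) = x 1 \<and>
    x (m + 2) * x (m + 2) = x 1 \<and>
    x (m + 3) * x (m + 3) = x (m + 4) \<and>
    x (m + 5) * x (m + 5) = x (m + 6) \<and>
    x (m + 7) * x (m + 7) = x (m + 8) \<and>
    x (m + 9) * x (m + 9) = x (m + 10) \<and>
    x (m + 4) + x (m + 6) = x (m + 11) \<and>
    x (m + 8) + x (m + 10) = x (m + 12) \<and>
    x (m + 11) + x (m + 12) = x (m + 13) \<and>
    x (m + 2) + x (m + 1) = x (m + 13)"
proof -
  have "m + 13 - 13 = m" "m + 13 - 11 = m + 2" "m + 13 - 10 = m + 3" "m + 13 - 9 = m + 4"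
    "m + 13 - 8 = m + 5" "m + 13 - 7 = m + 6" "m + 13 - 6 = m + 7" "m + 13 - 5 = m + 8"
    "m + 13 - 4 = m + 9" "m + 13 - 3 = m + 10" "m + 13 - 2 = m + 11" "m + 13 - 1 = m + 12"
    "m + 13 - 12 = m + 1"
    by auto
  then show ?thesis
    unfolding B_system_def by (simp only:)
qed

lemma T_system_shift:
  "T_system (m + 12) x \<longleftrightarrow>
    (\<forall>i\<in>{1..m}. x i * x i = x (i + 1)) \<and>
    x (m + 2) * x (m + 2) = x (m + 2) \<and>
    x (m + 2) + x (m + 2) = x (m + 3) \<and>
    x (m + 4) + x (m + 3) = x 1 \<and>
    x (m + 4) * x (m + 5) = x (m + 1) \<and>
    x (m + 2) * x (m + 5) = x (m + 5) \<and>
    x (m + 6) * x (m + 6) = x (m + 7) \<and>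
    x (m + 8) * x (m + 8) = x (m + 9) \<and>
    x (m + 10) * x (m + 10) = x (m + 11) \<and>
    x (m + 7) + x (m + 9) = x (m + 12) \<and>
    x (m + 11) + x (m + 12) = x (m + 1)"
proof -
  have "m + 12 - 12 = m" "m + 12 - 11 = m + 1" "m + 12 - 10 = m + 2" "m + 12 - 9 = m + 3"
    "m + 12 - 8 = m + 4" "m + 12 - 7 = m + 5" "m + 12 - 6 = m + 6" "m + 12 - 5 = m + 7"
    "m + 12 - 4 = m + 8" "m + 12 - 3 = m + 9" "m + 12 - 2 = m + 10" "m + 12 - 1 = m + 11"
    by auto
  then show ?thesis
    unfolding T_system_def by (simp only:)
qed

section \<open>Upper bound for system \<open>B\<close>\<close>

text \<open>For \<open>y = x (m + 2)\<close> the system gives \<open>y * y = 2 * y\<close> and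
  \<open>x 1 = 2 * y\<close>; the squaring chain then fixes the last coordinate as
  \<open>y + x 1 ^ (2 ^ m)\<close>.\<close>

lemma B_system_cases:
  assumes "B_system (m + 13) x"
  obtains "x (m + 2) = 0" "x (m + 13) = 0"
    | "x (m + 2) = 2" "x (m + 13) = 2 + (2 ^ 2 ^ m)\<^sup>2"
proof -
  note B = assms[unfolded B_system_shift]
  have "x (m + 2) * (x (m + 2) - 2) = 0"
    using B by (simp add: algebra_simps)
  moreover have "x (m + 13) = x (m + 2) + x 1 ^ (2 ^ m)"
    using B squaring_chain[of m x m] by simp
  moreover have "(4::int) ^ (2 ^ m) = (2 ^ 2 ^ m)\<^sup>2"
    by (metis power2_eq_square power_mult_distrib mult_2 numeral_Bit0)
  moreover have "x 1 = 2 * x (m + 2)"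
    using B by simp
  ultimately show ?thesis
    using that by (cases "x (m + 2) = 0") auto
qed

text \<open>The next square \<open>(L + 1) ^ 2\<close> exceeds \<open>L ^ 2\<close> by at least 3,
  so the extra 2 does not enlarge the range of a root.\<close>

lemma abs_le_if_square_le:
  fixes a L :: int
  assumes "a * a \<le> 2 + L\<^sup>2" "L \<ge> 1"
  shows "\<bar>a\<bar> \<le> L"
proof (rule ccontr)
  assume "\<not> \<bar>a\<bar> \<le> L"
  then have "(L + 1) * (L + 1) \<le> \<bar>a\<bar> * \<bar>a\<bar>"
    using assms by (intro mult_mono) auto
  then have "(L + 1) * (L + 1) \<le> a * a"
    by simp
  then show False
    using assms by (simp add: power2_eq_square algebra_simps)
qed

text \<open>The first entry separates \<open>x 1 = 0\<close> from \<open>x 1 = 4\<close>. The fourth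
  root enters by its sign only: its full range would give a bound of order
  \<open>16 ^ (2 ^ m)\<close>, too weak against \<open>9 ^ (2 ^ m)\<close>.\<close>

definition B_code :: "nat \<Rightarrow> (nat \<Rightarrow> int) \<Rightarrow> int \<times> int \<times> int \<times> int \<times> bool" where
  "B_code m x = (x (m + 2), x (m + 3), x (m + 5), x (m + 7), x (m + 9) \<ge> 0)"

lemma nat_index_cases:
  assumes "i \<in> {1..m + 13}"
  obtains j where "j \<le> m" "i = Suc j"
    | "i = m + 2" | "i = m + 3" | "i = m + 4" | "i = m + 5" | "i = m + 6" | "i = m + 7"
    | "i = m + 8" | "i = m + 9" | "i = m + 10" | "i = m + 11" | "i = m + 12" | "i = m + 13"
proof (cases "i \<le> Suc m")
  case True
  with assms have "i - 1 \<le> m" "i = Suc (i - 1)" by auto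
  then show ?thesis using that(1) by blast
next
  case False
  with assms have "2 \<le> i - m" "i - m \<le> 13" "i = m + (i - m)" by auto
  then have "i - m = 2 \<or> i - m = 3 \<or> i - m = 4 \<or> i - m = 5 \<or> i - m = 6 \<or> i - m = 7 \<or>
    i - m = 8 \<or> i - m = 9 \<or> i - m = 10 \<or> i - m = 11 \<or> i - m = 12 \<or> i - m = 13"
    by presburger
  with \<open>i = m + (i - m)\<close> consider "i = m + 2" | "i = m + 3" | "i = m + 4" | "i = m + 5" | "i = m + 6"
    | "i = m + 7" | "i = m + 8" | "i = m + 9" | "i = m + 10" | "i = m + 11" | "i = m + 12"
    | "i = m + 13"
    by metis
  then show ?thesis using that(2-) by cases blast+
qed

lemma inj_on_B_code: "inj_on (B_code m) (B_solutions (m + 13))"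
proof (rule inj_onI)
  fix x y
  assume x: "x \<in> B_solutions (m + 13)" and y: "y \<in> B_solutions (m + 13)"
    and eq: "B_code m x = B_code m y"
  note X = x[unfolded B_solutions_def mem_Collect_eq B_system_shift]
  note Y = y[unfolded B_solutions_def mem_Collect_eq B_system_shift]
  have same: "x (m + 2) = y (m + 2)" "x (m + 3) = y (m + 3)" "x (m + 5) = y (m + 5)"
    "x (m + 7) = y (m + 7)" "x (m + 9) \<ge> 0 \<longleftrightarrow> y (m + 9) \<ge> 0"
    using eq by (simp_all add: B_code_def)
  have one: "x 1 = y 1"
    using X Y same by metis
  have chain: "x (Suc j) = y (Suc j)" if "j \<le> m" for j
    using X Y one squaring_chain[of m x j] squaring_chain[of m y j] that by metis
  have same13: "x (m + 13) = y (m + 13)"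
    using X Y same chain[of m] by (metis Suc_eq_plus1 le_refl)
  have same468: "x (m + 4) = y (m + 4)" "x (m + 6) = y (m + 6)" "x (m + 8) = y (m + 8)"
    using X Y same by metis+
  have same10: "x (m + 11) = y (m + 11)" "x (m + 12) = y (m + 12)" "x (m + 10) = y (m + 10)"
    using X Y same13 same468 by linarith+
  then have "(x (m + 9))\<^sup>2 = (y (m + 9))\<^sup>2"
    using X Y by (simp add: power2_eq_square)
  \<comment> \<open>Equal squares leave a choice of sign, which the Boolean entry of the code
    settles; zero counts as nonnegative on both sides.\<close>
  then have same9: "x (m + 9) = y (m + 9)"
    using same(5) by (auto simp: power2_eq_iff)
  show "x = y"
  proof (rule PiE_ext)
    show "x \<in> {1..m + 13} \<rightarrow>\<^sub>E UNIV" "y \<in> {1..m + 13} \<rightarrow>\<^sub>E UNIV"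
      using X Y by auto
    fix i assume "i \<in> {1..m + 13}"
    then show "x i = y i"
      by (cases i m rule: nat_index_cases)
        (use chain same same9 same10 same13 same468 in simp_all)
  qed
qed

lemma B_code_range:
  assumes "x \<in> B_solutions (m + 13)"
  shows "B_code m x \<in> {0, 2} \<times> {- (2 ^ 2 ^ m)..2 ^ 2 ^ m} \<times> {- (2 ^ 2 ^ m)..2 ^ 2 ^ m} \<times>
    {- (2 ^ 2 ^ m)..2 ^ 2 ^ m} \<times> UNIV"
proof -
  let ?L = "2 ^ 2 ^ m :: int"
  have sys: "B_system (m + 13) x"
    using assms by (simp add: B_solutions_def)
  note B = sys[unfolded B_system_shift]
  have "x (m + 2) \<in> {0, 2} \<and> x (m + 13) \<le> 2 + ?L\<^sup>2"
    using sys by (cases rule: B_system_cases) auto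
  moreover have "x (m + 3) * x (m + 3) + x (m + 5) * x (m + 5) + x (m + 7) * x (m + 7)
      + x (m + 9) * x (m + 9) = x (m + 13)"
    using B by linarith
  moreover have "0 \<le> a * a" for a :: int by simp
  ultimately have "x (m + 3) * x (m + 3) \<le> 2 + ?L\<^sup>2" "x (m + 5) * x (m + 5) \<le> 2 + ?L\<^sup>2"
    "x (m + 7) * x (m + 7) \<le> 2 + ?L\<^sup>2" "x (m + 2) \<in> {0, 2}"
    by (smt (verit, best))+
  moreover have "?L \<ge> 1" by simp
  ultimately have "\<bar>x (m + 3)\<bar> \<le> ?L" "\<bar>x (m + 5)\<bar> \<le> ?L" "\<bar>x (m + 7)\<bar> \<le> ?L" "x (m + 2) \<in> {0, 2}"
    by (auto intro!: abs_le_if_square_le simp del: one_le_power)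
  then show ?thesis
    by (simp add: B_code_def abs_le_iff)
qed

lemma finite_B_solutions: "finite (B_solutions (m + 13))"
  by (rule inj_on_finite[OF inj_on_B_code image_subsetI[OF B_code_range]]) auto

text \<open>\<open>108 = 2 * 2 * 3 ^ 3\<close>: two leading values, two signs, and at most
  \<open>3 * 2 ^ 2 ^ m\<close> values for each of three roots.\<close>

lemma b_count_le: "b_count (m + 13) \<le> 108 * 8 ^ (2 ^ m)"
proof -
  let ?I = "{- (2 ^ 2 ^ m)..2 ^ 2 ^ m} :: int set"
  have "b_count (m + 13) \<le> card ({0, 2 :: int} \<times> ?I \<times> ?I \<times> ?I \<times> (UNIV :: bool set))"
    unfolding b_count_def
    by (rule card_inj_on_le[OF inj_on_B_code image_subsetI[OF B_code_range]]) auto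
  also have "\<dots> = 4 * card ?I ^ 3"
    by (simp add: card_cartesian_product power3_eq_cube)
  also have "card ?I = 2 * 2 ^ 2 ^ m + 1"
    by (simp add: nat_add_distrib nat_mult_distrib nat_power_eq)
  also have "4 * (2 * 2 ^ 2 ^ m + 1) ^ 3 \<le> 4 * (3 * 2 ^ 2 ^ m :: nat) ^ 3"
    by (intro mult_left_mono power_mono) auto
  also have "\<dots> = 108 * (2 ^ 2 ^ m) ^ 3"
    by (simp add: power_mult_distrib)
  also have "(2 ^ 2 ^ m :: nat) ^ 3 = (2 ^ 3) ^ 2 ^ m"
    by (metis power_mult mult.commute)
  finally show ?thesis
    by simp
qed

section \<open>Zero solutions, and finiteness of system \<open>T\<close>\<close>

lemma zero_mem_B_solutions: "restrict (\<lambda>_. 0) {1..m + 13} \<in> B_solutions (m + 13)"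
  by (simp add: B_solutions_def B_system_shift)

lemma zero_mem_T_solutions: "restrict (\<lambda>_. 0) {1..m + 12} \<in> T_solutions (m + 12)"
  by (simp add: T_solutions_def T_system_shift)

text \<open>The idempotent \<open>x (m + 2)\<close> is 0 or 1. If it is 0, then
  \<open>x (m + 5)\<close>, \<open>x (m + 1)\<close>, \<open>x 1\<close> and
  \<open>x (m + 4)\<close> vanish in turn. If it is 1, then \<open>x (m + 4) = x 1 - 2\<close>, a
  divisor of a power of 2.\<close>

lemma T_system_factor_bounds:
  assumes "T_system (m + 12) x"
  shows "\<bar>x (m + 4)\<bar> \<le> 2 ^ 2 ^ m" "\<bar>x (m + 5)\<bar> \<le> \<bar>x (m + 1)\<bar>" "x (m + 2) \<in> {0, 1}"
proof -
  note T = assms[unfolded T_system_shift]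
  have chain: "x (m + 1) = x 1 ^ (2 ^ m)"
    using T squaring_chain[of m x m] by simp
  have "x (m + 2) * (x (m + 2) - 1) = 0"
    using T by (simp add: algebra_simps)
  then consider "x (m + 2) = 0" | "x (m + 2) = 1"
    by auto
  then have "\<bar>x (m + 4)\<bar> \<le> 2 ^ 2 ^ m \<and> \<bar>x (m + 5)\<bar> \<le> \<bar>x (m + 1)\<bar> \<and> x (m + 2) \<in> {0, 1}"
  proof cases
    case 1
    then have "x (m + 5) = 0" "x (m + 3) = 0" using T by auto
    then have "x 1 ^ (2 ^ m) = 0" using T chain by auto
    then have "x 1 = 0" by simp
    then show ?thesis
      using T 1 \<open>x (m + 5) = 0\<close> \<open>x (m + 3) = 0\<close> by simp
  next
    case 2
    then have x1: "x 1 = x (m + 4) + 2" using T by simp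
    \<comment> \<open>A difference \<open>a ^ k - 2 ^ k\<close> is divisible by
      \<open>a - 2\<close>.\<close>
    have "x (m + 4) dvd x 1 ^ (2 ^ m) - 2 ^ 2 ^ m"
      using x1 power_diff_sumr2[of "x 1" "2 ^ m" 2] by simp
    moreover have "x (m + 4) dvd x 1 ^ (2 ^ m)"
      using T chain by (metis dvd_triv_left)
    ultimately have dvd: "x (m + 4) dvd 2 ^ 2 ^ m"
      by (metis dvd_diffD1 dvd_diff_commute dvd_diff diff_diff_eq2 add_diff_cancel_left'
          diff_add_cancel)
    then have "\<bar>x (m + 4)\<bar> \<le> 2 ^ 2 ^ m"
      using dvd_imp_le_int[of "2 ^ 2 ^ m" "x (m + 4)"] by simp
    moreover have "x (m + 4) \<noteq> 0"
      using dvd by auto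
    then have "1 * \<bar>x (m + 5)\<bar> \<le> \<bar>x (m + 4)\<bar> * \<bar>x (m + 5)\<bar>"
      by (intro mult_right_mono) auto
    then have "\<bar>x (m + 5)\<bar> \<le> \<bar>x (m + 1)\<bar>"
      using T by (metis abs_mult mult_1)
    ultimately show ?thesis
      using 2 by simp
  qed
  then show "\<bar>x (m + 4)\<bar> \<le> 2 ^ 2 ^ m" "\<bar>x (m + 5)\<bar> \<le> \<bar>x (m + 1)\<bar>" "x (m + 2) \<in> {0, 1}"
    by auto
qed

text \<open>\<open>D\<close> bounds \<open>x 1\<close>, hence \<open>C\<close> bounds the chain. The
  three squares are nonnegative with sum \<open>x (m + 1)\<close>, so they, their roots and the
  partial sum are at most \<open>C\<close> too.\<close>

lemma T_system_bound:
  assumes "T_system (m + 12) x" "i \<in> {1..m + 12}"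
  shows "\<bar>x i\<bar> \<le> (2 + 2 ^ 2 ^ m) ^ (2 ^ m)"
proof -
  define D :: int where "D = 2 + 2 ^ 2 ^ m"
  define C where "C = D ^ (2 ^ m)"
  note T = assms(1)[unfolded T_system_shift]
  note F = T_system_factor_bounds[OF assms(1)]
  have D: "D \<ge> 2" by (simp add: D_def)
  have x1: "\<bar>x 1\<bar> \<le> D"
    using F T by (auto simp: D_def)
  have chain: "\<bar>x (Suc j)\<bar> \<le> C" if "j \<le> m" for j
  proof -
    have "\<bar>x (Suc j)\<bar> = \<bar>x 1\<bar> ^ (2 ^ j)"
      using T squaring_chain[of m x j] that by (metis power_abs)
    also have "\<dots> \<le> D ^ (2 ^ j)"
      using x1 by (intro power_mono) auto
    also have "\<dots> \<le> C"
      unfolding C_def using D that by (intro power_increasing) auto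
    finally show ?thesis .
  qed
  have DC: "D \<le> C"
    unfolding C_def using D power_increasing[of 1 "2 ^ m" D] by simp
  have m1: "\<bar>x (m + 1)\<bar> \<le> C"
    using chain[of m] by simp
  have "\<bar>x (m + 2)\<bar> \<le> D" "\<bar>x (m + 3)\<bar> \<le> D" "\<bar>x (m + 4)\<bar> \<le> D"
    using F T by (auto simp: D_def)
  then have small: "\<bar>x (m + 2)\<bar> \<le> C" "\<bar>x (m + 3)\<bar> \<le> C" "\<bar>x (m + 4)\<bar> \<le> C"
    using DC by linarith+
  have m5: "\<bar>x (m + 5)\<bar> \<le> C"
    using F(2) m1 by linarith
  have sum: "x (m + 7) + x (m + 9) = x (m + 12)" "x (m + 11) + x (m + 12) = x (m + 1)"
    using T by blast+
  have roots: "\<bar>x (m + 6)\<bar> \<le> x (m + 7)" "\<bar>x (m + 8)\<bar> \<le> x (m + 9)"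
    "\<bar>x (m + 10)\<bar> \<le> x (m + 11)"
    using T abs_le_self_mult by metis+
  then have "0 \<le> x (m + 7)" "0 \<le> x (m + 9)" "0 \<le> x (m + 11)"
    by linarith+
  moreover from m1 have "x (m + 1) \<le> C"
    by linarith
  ultimately have squares: "\<bar>x (m + 7)\<bar> \<le> C" "\<bar>x (m + 9)\<bar> \<le> C" "\<bar>x (m + 11)\<bar> \<le> C" "\<bar>x (m + 12)\<bar> \<le> C"
    using sum by linarith+
  then have "\<bar>x (m + 6)\<bar> \<le> C" "\<bar>x (m + 8)\<bar> \<le> C" "\<bar>x (m + 10)\<bar> \<le> C"
    using roots by linarith+
  note large = this squares
  have "i \<in> {1..m + 13}" "i \<noteq> m + 13"
    using assms(2) by auto
  then have "\<bar>x i\<bar> \<le> C"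
    by (cases i m rule: nat_index_cases) (use chain small m5 large in blast)+
  then show ?thesis
    by (simp add: C_def D_def)
qed

lemma finite_T_solutions: "finite (T_solutions (m + 12))"
proof (rule finite_subset)
  let ?C = "(2 + 2 ^ 2 ^ m) ^ (2 ^ m) :: int"
  show "T_solutions (m + 12) \<subseteq> {1..m + 12} \<rightarrow>\<^sub>E {- ?C..?C}"
  proof
    fix x assume "x \<in> T_solutions (m + 12)"
    then have x: "x \<in> {1..m + 12} \<rightarrow>\<^sub>E UNIV" "T_system (m + 12) x"
      by (auto simp: T_solutions_def)
    show "x \<in> {1..m + 12} \<rightarrow>\<^sub>E {- ?C..?C}"
    proof (rule PiE_I)
      fix i assume "i \<in> {1..m + 12}"
      then show "x i \<in> {- ?C..?C}"
        using T_system_bound[OF x(2)] by (simp add: abs_le_iff minus_le_iff)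
    qed (use x in auto)
  qed
qed (simp add: finite_PiE)

section \<open>Sphere points as solutions of system \<open>T\<close>\<close>

text \<open>Below, \<open>n = m + 13\<close> and \<open>K = 2 ^ m\<close>; the three roots are \<open>2 ^ K\<close> times the coordinates of
  a point on the sphere of radius \<open>17 ^ K\<close>. The coordinate with index \<open>m + 6\<close> is
  \<open>34 ^ (2 K) div 32\<close>, and the division is exact only if \<open>2 K \<ge> 5\<close>, i.e. \<open>m \<ge> 2\<close>.\<close>

fun sphere_solution :: "nat \<Rightarrow> vec3 \<Rightarrow> nat \<Rightarrow> int" where
  "sphere_solution m (a, b, c) = (\<lambda>i\<in>{1..m + 13}.
    if i \<le> m + 2 then 34 ^ (2 ^ (i - 1))
    else [1, 2, 32, 34 ^ (2 ^ Suc m) div 32,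
      2 ^ 2 ^ m * a, (2 ^ 2 ^ m * a)\<^sup>2, 2 ^ 2 ^ m * b, (2 ^ 2 ^ m * b)\<^sup>2,
      2 ^ 2 ^ m * c, (2 ^ 2 ^ m * c)\<^sup>2,
      (2 ^ 2 ^ m * a)\<^sup>2 + (2 ^ 2 ^ m * b)\<^sup>2] ! (i - (m + 3)))"

lemma sphere_solution_mem:
  assumes "v \<in> sphere17 (2 ^ m)" "m \<ge> 2"
  shows "sphere_solution m v \<in> T_solutions (m + 13)"
proof -
  obtain a b c where v: "v = (a, b, c)" by (cases v)
  let ?s = "2 ^ 2 ^ m :: int"
  let ?x = "sphere_solution m (a, b, c)"
  have pow: "(34::int) ^ (2 ^ Suc m) = ?s\<^sup>2 * (17 ^ 2 ^ m)\<^sup>2"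
  proof -
    have "(34::int) ^ (2 ^ Suc m) = ((2 * 17) ^ 2 ^ m)\<^sup>2"
      by (simp flip: power_mult add: mult.commute)
    then show ?thesis
      by (simp only: power_mult_distrib)
  qed
  have sum: "(?s * c)\<^sup>2 + ((?s * a)\<^sup>2 + (?s * b)\<^sup>2) = 34 ^ (2 ^ Suc m)"
  proof -
    have "a * a + b * b + c * c = (17 ^ 2 ^ m)\<^sup>2"
      using assms(1) by (simp add: sphere17_def v)
    then have "?s\<^sup>2 * (a * a + b * b + c * c) = 34 ^ (2 ^ Suc m)"
      by (simp only: pow)
    then show ?thesis
      by (simp only: power_mult_distrib power2_eq_square algebra_simps)
  qed
  have exact: "(32::int) dvd 34 ^ (2 ^ Suc m)"
  proof -
    \<comment> \<open>The exponent is at least 8, and already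
      \<open>34 ^ 5 = 32 * 17 ^ 5\<close>.\<close>
    have "(2::nat) ^ 3 \<le> 2 ^ Suc m"
      using assms(2) by (intro power_increasing) auto
    then have "(34::int) ^ 5 dvd 34 ^ (2 ^ Suc m)"
      by (intro le_imp_power_dvd) simp
    then show ?thesis
      by (rule dvd_trans[rotated]) simp
  qed
  have chain: "?x i = 34 ^ (2 ^ (i - 1))" if "i \<in> {1..m + 2}" for i
    using that by simp
  have step: "?x i * ?x i = ?x (i + 1)" if i: "i \<in> {1..Suc m}" for i
  proof -
    obtain j where "i = Suc j" using i by (cases i) auto
    then show ?thesis
      using i by (simp flip: power_add add: mult_2)
  qed
  \<comment> \<open>For the same \<open>n\<close> the chain of \<open>T\<close> is one squaring
    longer than that of \<open>B\<close>, so it ends in \<open>34 ^ (2 ^ Suc m)\<close>, the squared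
    radius.\<close>
  have shift: "m + 13 = Suc m + 12" by simp
  have "T_system (Suc m + 12) ?x"
    unfolding T_system_shift
  proof (intro conjI ballI)
    fix i assume "i \<in> {1..Suc m}"
    then show "?x i * ?x i = ?x (i + 1)" by (rule step)
  next
    show "?x (Suc m + 11) + ?x (Suc m + 12) = ?x (Suc m + 1)"
      using sum by simp
  next
    show "?x (Suc m + 4) * ?x (Suc m + 5) = ?x (Suc m + 1)"
      using exact by simp
  qed (simp_all add: power2_eq_square)
  moreover have "?x \<in> {1..m + 13} \<rightarrow>\<^sub>E UNIV"
    by auto
  ultimately show ?thesis
    unfolding T_solutions_def v shift by blast
qed

lemma inj_sphere_solution: "inj (sphere_solution m)"
proof (rule injI)
  fix v w assume eq: "sphere_solution m v = sphere_solution m w"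
  obtain a b c a' b' c' where vw: "v = (a, b, c)" "w = (a', b', c')"
    by (cases v; cases w)
  show "v = w"
    using fun_cong[OF eq, of "m + 7"] fun_cong[OF eq, of "m + 9"] fun_cong[OF eq, of "m + 11"]
    by (simp add: vw)
qed

lemma t_count_ge:
  assumes "m \<ge> 2"
  shows "9 ^ (2 ^ m) \<le> 9 * t_count (m + 13)"
proof -
  have "9 ^ (2 ^ m) = 9 * 9 ^ (2 ^ m - 1 :: nat)"
    by (simp flip: power_Suc)
  also have "(9::nat) ^ (2 ^ m - 1) \<le> card (sphere17 (2 ^ m))"
    using card_sphere17[of "2 ^ m - 1"] by simp
  also have "card (sphere17 (2 ^ m)) \<le> t_count (m + 13)"
    unfolding t_count_def
  proof (rule card_inj_on_le)
    show "inj_on (sphere_solution m) (sphere17 (2 ^ m))"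
      using inj_sphere_solution by (rule inj_on_subset) simp
    show "sphere_solution m ` sphere17 (2 ^ m) \<subseteq> T_solutions (m + 13)"
      using sphere_solution_mem assms by blast
    show "finite (T_solutions (m + 13))"
      using finite_T_solutions[of "Suc m"] by (simp add: add.commute)
  qed
  finally show ?thesis
    by simp
qed

section \<open>Positivity and growth of the quotient\<close>

lemma b_count_pos: "b_count (m + 13) > 0"
  using zero_mem_B_solutions[of m] finite_B_solutions[of m]
  by (auto simp: b_count_def card_gt_0_iff)

lemma t_count_pos: "t_count (m + 12) > 0"
  using zero_mem_T_solutions[of m] finite_T_solutions[of m]
  by (auto simp: t_count_def card_gt_0_iff)

text \<open>\<open>972 = 9 * 108\<close> collects the two constants. Lowering the exponent
  \<open>2 ^ m\<close> to \<open>m\<close> leaves a geometric sequence.\<close>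

lemma ratio_ge:
  assumes "m \<ge> 2"
  shows "(9 / 8) ^ m / 972 \<le> real (t_count (m + 13)) / real (b_count (m + 13))"
proof -
  have "(9 / 8 :: real) ^ m \<le> (9 / 8) ^ (2 ^ m)"
    by (intro power_increasing) (auto simp: less_imp_le)
  then have "(9 / 8) ^ m / 972 \<le> (9 / 8 :: real) ^ (2 ^ m) / 972"
    by simp
  also have "\<dots> = (9 ^ (2 ^ m) / 9) / (108 * 8 ^ (2 ^ m))"
    by (simp add: power_divide)
  also have "\<dots> \<le> real (t_count (m + 13)) / real (b_count (m + 13))"
  proof (rule frac_le)
    have "real (9 ^ (2 ^ m)) \<le> real (9 * t_count (m + 13))"
      using t_count_ge[OF assms] by (simp only: of_nat_le_iff)
    then show "9 ^ (2 ^ m) / 9 \<le> real (t_count (m + 13))"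
      by simp
    have "real (b_count (m + 13)) \<le> real (108 * 8 ^ (2 ^ m))"
      using b_count_le by (simp only: of_nat_le_iff)
    then show "real (b_count (m + 13)) \<le> 108 * 8 ^ (2 ^ m)"
      by simp
  qed (use b_count_pos in auto)
  finally show ?thesis .
qed

theorem theorem3:
  shows "(\<forall>n\<ge>13. finite (B_solutions n) \<and> b_count n > 0) \<and>
         (\<forall>n\<ge>12. finite (T_solutions n) \<and> t_count n > 0) \<and>
         filterlim (\<lambda>n. real (t_count n) / real (b_count n)) at_top sequentially"
proof (intro conjI allI impI)
  fix n :: nat assume "n \<ge> 13"
  then obtain m where "n = m + 13" by (metis le_add_diff_inverse2)
  then show "finite (B_solutions n)" "b_count n > 0"
    using finite_B_solutions b_count_pos by auto
next
  fix n :: nat assume "n \<ge> 12"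
  then obtain m where "n = m + 12" by (metis le_add_diff_inverse2)
  then show "finite (T_solutions n)" "t_count n > 0"
    using finite_T_solutions t_count_pos by auto
next
  \<comment> \<open>Powers of a number above 1 are known to tend to \<open>at_infinity\<close>; the
    norm turns this into \<open>at_top\<close>.\<close>
  have "filterlim (\<lambda>m. norm ((9 / 8 :: real) ^ m)) at_top sequentially"
    by (intro filterlim_at_infinity_imp_norm_at_top filterlim_realpow_sequentially_gt1) simp
  then have "filterlim (\<lambda>m. (1 / 972) * (9 / 8 :: real) ^ m) at_top sequentially"
    by (intro filterlim_tendsto_pos_mult_at_top[OF tendsto_const])
      (simp_all add: norm_power)
  then have "filterlim (\<lambda>m. real (t_count (m + 13)) / real (b_count (m + 13))) at_top sequentially"
    by (rule filterlim_at_top_mono)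
      (use ratio_ge in \<open>auto simp: eventually_sequentially intro!: exI[of _ 2]\<close>)
  \<comment> \<open>The limit along \<open>m\<close> is carried back to \<open>n = m + 13\<close>,
    since divergence ignores the first 13 terms.\<close>
  then show "filterlim (\<lambda>n. real (t_count n) / real (b_count n)) at_top sequentially"
    unfolding filterlim_at_top
    using eventually_sequentially_seg[where k = 13
        and P = "\<lambda>n. Z \<le> real (t_count n) / real (b_count n)" for Z]
    by simp
qed

end
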